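(* Let $t\ge 1$ be an integer. For every real $\varepsilon$ with $0<\varepsilon<2$ there is an integer $N_{\varepsilon,t}$ such that Player 1 has a strategy in the $(1:t)$ biased binary sequence game which ensures that any two identical blocks of length $n>N_{\varepsilon,t}$ in the resulting infinite sequence lie at distance greater than $(2-\varepsilon)^{n/(t+1)}$. That is, whatever Player 2 does, the resulting sequence $\alpha_1\alpha_2\alpha_3\dots$ has the property that for all integers $0\le k<\ell$ and $n>N_{\varepsilon,t}$, if $\alpha_{k+i}=\alpha_{\ell+i}$ for all $1\le i\le n$, then $\ell-k>(2-\varepsilon)^{n/(t+1)}$.
   Context: The $(1:t)$ biased binary sequence game: two players choose digits from $\{0,1\}$ one after another, forming an unending sequence $\alpha_1\alpha_2\alpha_3\dots$. Player 1 chooses $\alpha_j$ for $j\equiv 1\pmod{t+1}$, and Player 2 chooses all other terms (so Player 2 makes $t$ moves between consecutive moves of Player 1); each choice is made with full knowledge of all previous choices. A strategy for Player 1 is a function assigning to each finite history ending just before a move of Player 1 the digit he plays. It ensures a property if every infinite sequence resulting from play in which Player 1 follows the strategy (with arbitrary moves by Player 2) has that property. A block of length $n$ is a string of $n$ consecutive terms $\alpha_{k+1},\dots,\alpha_{k+n}$ ($k\ge 0$). The distance between the (possibly overlapping) blocks $\alpha_{k+1},\dots,\alpha_{k+n}$ and $\alpha_{\ell+1},\dots,\alpha_{\ell+n}$ with $k<\ell$ is $\ell-k$. *)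

theory Defs
  imports Complex_Main "HOL-Number_Theory.Cong"
begin

text \<open>
  The digits 0 and 1 are \<^term>\<open>False\<close> and \<^term>\<open>True\<close>. A play is a function
  \<open>\<alpha> :: nat \<Rightarrow> bool\<close> whose terms are \<open>\<alpha> 1\<close>, \<open>\<alpha> 2\<close>, \<open>\<alpha> 3\<close>, \<open>\<dots>\<close>; the value \<open>\<alpha> 0\<close> is not part
  of the play, and nothing below depends on it.
\<close>

definition player1_turn :: "nat \<Rightarrow> nat \<Rightarrow> bool" where
  "player1_turn t j \<longleftrightarrow> j \<ge> 1 \<and> [j = 1] (mod (t + 1))"

text \<open>
  A history is the list of all digits chosen so far, oldest first. A strategy is a total function
  on lists, but only its values on histories that end just before a turn of Player 1 are used.
\<close>

type_synonym strategy = "bool list \<Rightarrow> bool"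

definition history :: "(nat \<Rightarrow> bool) \<Rightarrow> nat \<Rightarrow> bool list" where
  "history \<alpha> j = map \<alpha> [1..<j]"

definition follows :: "nat \<Rightarrow> strategy \<Rightarrow> (nat \<Rightarrow> bool) \<Rightarrow> bool" where
  "follows t \<sigma> \<alpha> \<longleftrightarrow> (\<forall>j. player1_turn t j \<longrightarrow> \<alpha> j = \<sigma> (history \<alpha> j))"

text \<open>
  The terms at the turns of Player 2 are unconstrained in \<^const>\<open>follows\<close>, so the quantifier over
  \<open>\<alpha>\<close> ranges over all behaviours of Player 2.
\<close>

definition ensures :: "nat \<Rightarrow> strategy \<Rightarrow> ((nat \<Rightarrow> bool) \<Rightarrow> bool) \<Rightarrow> bool" where
  "ensures t \<sigma> P \<longleftrightarrow> (\<forall>\<alpha>. follows t \<sigma> \<alpha> \<longrightarrow> P \<alpha>)"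

definition identical_blocks :: "(nat \<Rightarrow> bool) \<Rightarrow> nat \<Rightarrow> nat \<Rightarrow> nat \<Rightarrow> bool" where
  "identical_blocks \<alpha> n k l \<longleftrightarrow> (\<forall>i\<in>{1..n}. \<alpha> (k + i) = \<alpha> (l + i))"

end

theory Submission
  imports Defs
begin

text \<open>
  The condition is closed, so if no strategy of Player 1 ensures it then Player 2 has a strategy
  \<open>\<tau>\<close> that spoils every play within a bounded number of moves. Against a fixed \<open>\<tau>\<close> a play is
  determined by the choices of Player 1, and the unspoiled plays can be counted as in Rosenfeld's
  method: each of the \<open>C m\<close> unspoiled plays of \<open>m\<close> rounds has two continuations by one round, and
  a continuation that completes a repetition of length \<open>n\<close> at a given distance and position is
  determined by its first \<open>m + 1 - n div (t + 1)\<close> rounds. Hence \<open>C (m + 1)\<close> is at least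
  \<open>2 * C m\<close> minus a sum of earlier values, and induction gives \<open>C (m + 1) \<ge> \<beta> * C m\<close> with
  \<open>\<beta> = 2 - \<epsilon> / 2\<close>, because the distances allowed for length \<open>n\<close> number at most
  \<open>(2 - \<epsilon>) powr (n / (t + 1))\<close>. So \<open>C m\<close> never vanishes, and \<open>\<tau>\<close> cannot exist.
\<close>

section \<open>Determinacy\<close>

text \<open>\<open>T\<close> marks the list positions at which Player 1 moves and \<open>B\<close>
  the histories already lost for him. The recursion says that Player 2 can force \<open>B\<close>
  within \<open>m\<close> further digits.\<close>

fun loses :: "(nat \<Rightarrow> bool) \<Rightarrow> (bool list \<Rightarrow> bool) \<Rightarrow> nat \<Rightarrow> bool list \<Rightarrow> bool" where
  "loses T B 0 h \<longleftrightarrow> B h"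
| "loses T B (Suc m) h \<longleftrightarrow> B h \<or>
     (if T (length h) then \<forall>b. loses T B m (h @ [b]) else \<exists>b. loses T B m (h @ [b]))"

definition answers :: "(nat \<Rightarrow> bool) \<Rightarrow> strategy \<Rightarrow> bool list \<Rightarrow> bool" where
  "answers T \<tau> h \<longleftrightarrow> (\<forall>j<length h. \<not> T j \<longrightarrow> h ! j = \<tau> (take j h))"

lemma loses_if_bad: "B h \<Longrightarrow> loses T B m h"
  by (cases m) auto

lemma loses_Suc: "loses T B m h \<Longrightarrow> loses T B (Suc m) h"
proof (induction m arbitrary: h)
  case 0
  then show ?case by simp
next
  case (Suc m)
  then show ?case
    unfolding loses.simps(2)[of T B "Suc m" h] loses.simps(2)[of T B m h]
    by (auto simp del: loses.simps split: if_splits)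
qed

lemma loses_mono: "m \<le> m' \<Longrightarrow> loses T B m h \<Longrightarrow> loses T B m' h"
  by (induction m' rule: dec_induct) (auto simp del: loses.simps intro: loses_Suc)

text \<open>Player 1 keeps to positions that are lost for no bound \<open>m\<close>. A safe digit
  exists because there are only two: if both lost, the larger of their bounds would make the current
  position lose too.\<close>

lemma winning_strategy_if_never_loses:
  assumes "\<And>m. \<not> loses T B m []"
  shows "\<exists>\<sigma>. \<forall>\<alpha>. (\<forall>j. T j \<longrightarrow> \<alpha> j = \<sigma> (map \<alpha> [0..<j])) \<longrightarrow> (\<forall>n. \<not> B (map \<alpha> [0..<n]))"
proof -
  define safe where "safe h \<longleftrightarrow> (\<forall>m. \<not> loses T B m h)" for h
  define \<sigma> where "\<sigma> h = (SOME b. safe (h @ [b]))" for h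
  have own: "safe (h @ [\<sigma> h])" if "safe h" "T (length h)" for h
  proof -
    have "\<exists>b. safe (h @ [b])"
    proof (rule ccontr)
      assume "\<nexists>b. safe (h @ [b])"
      then obtain f where f: "\<And>b. loses T B (f b) (h @ [b])"
        unfolding safe_def by metis
      have "loses T B (max (f True) (f False)) (h @ [b])" for b
        by (rule loses_mono[OF _ f[of b]]) (cases b; simp)
      then have "loses T B (Suc (max (f True) (f False))) h"
        using \<open>T (length h)\<close> by simp
      with \<open>safe h\<close> show False by (simp add: safe_def del: loses.simps)
    qed
    then show ?thesis unfolding \<sigma>_def by (rule someI_ex)
  qed
  have other: "safe (h @ [b])" if "safe h" "\<not> T (length h)" for h b
    unfolding safe_def
  proof (intro allI notI)
    fix m assume "loses T B m (h @ [b])"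
    then have "loses T B (Suc m) h" using that(2) by auto
    with that(1) show False by (simp add: safe_def del: loses.simps)
  qed
  have "\<not> B (map \<alpha> [0..<n])" if \<alpha>: "\<And>j. T j \<Longrightarrow> \<alpha> j = \<sigma> (map \<alpha> [0..<j])" for \<alpha> n
  proof -
    have "safe (map \<alpha> [0..<n])"
    proof (induction n)
      case 0
      then show ?case using assms by (simp add: safe_def)
    next
      case (Suc n)
      then show ?case using own[OF Suc] other[OF Suc, of "\<alpha> n"] \<alpha>[of n]
        by (cases "T n") auto
    qed
    then show ?thesis by (auto simp: safe_def dest: loses_if_bad)
  qed
  then show ?thesis by blast
qed

text \<open>Player 2 always keeps the position lost with one move less to spare. The moves left are
  read off from the length of the history, so \<open>\<tau>\<close> needs no other memory; when none
  are left, \<open>loses\<close> is \<open>B\<close> itself.\<close>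

lemma spoiling_strategy_if_loses:
  assumes "loses T B M []"
  shows "\<exists>\<tau>. \<forall>h. answers T \<tau> h \<and> M \<le> length h \<longrightarrow> (\<exists>n\<le>M. B (take n h))"
proof -
  define \<tau> where "\<tau> h = (SOME b. loses T B (M - Suc (length h)) (h @ [b]))" for h
  have "\<exists>n\<le>M. B (take n h)" if h: "answers T \<tau> h" "M \<le> length h" for h
  proof (rule ccontr)
    assume good: "\<not> ?thesis"
    have "loses T B (M - n) (take n h)" if "n \<le> M" for n
      using that
    proof (induction n)
      case 0
      then show ?case using assms by simp
    next
      case (Suc n)
      let ?p = "take n h"
      have n: "n < length h" "length ?p = n" using Suc.prems h(2) by auto
      have next_p: "take (Suc n) h = ?p @ [h ! n]" using n by (simp add: take_Suc_conv_app_nth)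
      have "M - n = Suc (M - Suc n)" using Suc.prems by simp
      moreover have "\<not> B ?p" using good Suc.prems by auto
      ultimately have step: "if T n then \<forall>b. loses T B (M - Suc n) (?p @ [b])
          else \<exists>b. loses T B (M - Suc n) (?p @ [b])"
        using Suc n(2) by simp
      show ?case
      proof (cases "T n")
        case True
        then show ?thesis using step next_p by simp
      next
        case False
        then have "loses T B (M - Suc n) (?p @ [\<tau> ?p])"
          using step n(2) unfolding \<tau>_def by (simp, metis someI_ex)
        then show ?thesis using False h(1) n(1) next_p by (simp add: answers_def)
      qed
    qed
    from this[of M] have "B (take M h)" by simp
    with good show False by blast
  qed
  then show ?thesis by blast
qed

text \<open>This exchanges quantifiers: it is enough to survive each single \<open>\<tau>\<close> up
  to each finite bound \<open>M\<close>, by a play that may depend on both.\<close>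

theorem closed_game_determined:
  assumes "\<And>\<tau> M. \<exists>h. answers T \<tau> h \<and> M \<le> length h \<and> (\<forall>n\<le>M. \<not> B (take n h))"
  shows "\<exists>\<sigma>. \<forall>\<alpha>. (\<forall>j. T j \<longrightarrow> \<alpha> j = \<sigma> (map \<alpha> [0..<j])) \<longrightarrow> (\<forall>n. \<not> B (map \<alpha> [0..<n]))"
proof (rule winning_strategy_if_never_loses, rule notI)
  fix M assume "loses T B M []"
  then obtain \<tau> where "\<And>h. answers T \<tau> h \<Longrightarrow> M \<le> length h \<Longrightarrow> \<exists>n\<le>M. B (take n h)"
    using spoiling_strategy_if_loses[of T B M] by auto
  moreover obtain h where "answers T \<tau> h" "M \<le> length h" "\<forall>n\<le>M. \<not> B (take n h)"
    using assms[of \<tau> M] by auto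
  ultimately show False by blast
qed

section \<open>Counting the unspoiled plays against a fixed strategy\<close>

text \<open>\<open>n\<close> is the block length, \<open>d\<close> the distance and \<open>e\<close>
  the exclusive end of the later block; overlaps, \<open>d < n\<close>, are included. Recording the
  end makes a new repetition recognisable by \<open>e\<close> lying in the last round.\<close>

definition repeats :: "nat \<Rightarrow> nat \<Rightarrow> nat \<Rightarrow> bool list \<Rightarrow> bool" where
  "repeats n d e h \<longleftrightarrow> d + n \<le> e \<and> e \<le> length h \<and> (\<forall>i\<in>{e - n..<e}. h ! i = h ! (i - d))"

text \<open>\<open>D n\<close> is the largest forbidden distance for length \<open>n\<close>; the
  value 0 forbids nothing.\<close>

definition spoiled :: "(nat \<Rightarrow> nat) \<Rightarrow> bool list \<Rightarrow> bool" where
  "spoiled D h \<longleftrightarrow> (\<exists>n e. \<exists>d\<in>{1..D n}. repeats n d e h)"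

abbreviation first_turn :: "nat \<Rightarrow> nat \<Rightarrow> bool" where
  "first_turn r j \<equiv> j mod r = 0"

definition plays :: "nat \<Rightarrow> strategy \<Rightarrow> (nat \<Rightarrow> nat) \<Rightarrow> nat \<Rightarrow> bool list set" where
  "plays r \<tau> D m = {h. length h = m * r \<and> answers (first_turn r) \<tau> h \<and> \<not> spoiled D h}"

lemma answers_take: "answers T \<tau> h \<Longrightarrow> answers T \<tau> (take n h)"
  by (auto simp: answers_def min_def)

lemma repeats_take: "e \<le> n \<Longrightarrow> repeats k d e h \<Longrightarrow> repeats k d e (take n h)"
  unfolding repeats_def
  by (metis atLeastLessThan_iff length_take less_imp_diff_less min.bounded_iff nth_take order.strict_trans2)

lemma spoiled_take: "spoiled D (take n h) \<Longrightarrow> spoiled D h"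
  by (fastforce simp: spoiled_def repeats_def)

lemma finite_plays: "finite (plays r \<tau> D m)"
  by (rule finite_subset[OF _ finite_lists_length_eq[of UNIV "m * r"]]) (auto simp: plays_def)

lemma take_in_plays: "h \<in> plays r \<tau> D m \<Longrightarrow> q \<le> m \<Longrightarrow> take (q * r) h \<in> plays r \<tau> D q"
  by (auto simp: plays_def answers_take dest: spoiled_take)

lemma card_plays_0: 
  assumes "D 0 = 0"
  shows "card (plays r \<tau> D 0) = 1"
proof -
  have "plays r \<tau> D 0 = {[]}"
    using assms by (auto simp: plays_def answers_def spoiled_def repeats_def)
  then show ?thesis by simp
qed

section \<open>One-round continuations and a recurrence for the number of plays\<close>

definition continuations :: "nat \<Rightarrow> strategy \<Rightarrow> (nat \<Rightarrow> nat) \<Rightarrow> nat \<Rightarrow> bool list set" where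
  "continuations r \<tau> D m = {h. length h = Suc m * r \<and> answers (first_turn r) \<tau> h \<and>
     \<not> spoiled D (take (m * r) h)}"

lemma finite_continuations: "finite (continuations r \<tau> D m)"
  by (rule finite_subset[OF _ finite_lists_length_eq[of UNIV "Suc m * r"]])
    (auto simp: continuations_def)

lemma answers_snoc:
  "answers T \<tau> (h @ [b]) \<longleftrightarrow> answers T \<tau> h \<and> (\<not> T (length h) \<longrightarrow> b = \<tau> h)"
  by (auto simp: answers_def nth_append less_Suc_eq)

lemma extend_by_answers:
  assumes "answers T \<tau> h" and "\<And>j. length h \<le> j \<Longrightarrow> j < length h + k \<Longrightarrow> \<not> T j"
  shows "\<exists>g. length g = k \<and> answers T \<tau> (h @ g)"
  using assms(2)
proof (induction k)
  case 0
  then show ?case using assms(1) by simp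
next
  case (Suc k)
  then obtain g where g: "length g = k" "answers T \<tau> (h @ g)" by auto
  then have "answers T \<tau> ((h @ g) @ [\<tau> (h @ g)])" by (simp add: answers_snoc del: append_assoc)
  then show ?case using g(1) by (intro exI[of _ "g @ [\<tau> (h @ g)]"]) simp
qed

text \<open>Player 1 opens the new round with either digit and \<open>\<tau>\<close> dictates the
  rest. The digits up to and including that choice recover the pair of play and choice, so the map
  is injective.\<close>

lemma card_continuations:
  assumes "0 < r"
  shows "2 * card (plays r \<tau> D m) \<le> card (continuations r \<tau> D m)"
proof -
  have "\<exists>h'\<in>continuations r \<tau> D m. take (Suc (m * r)) h' = h @ [b]"
    if "h \<in> plays r \<tau> D m" for h b
  proof -
    have h: "length h = m * r" "answers (first_turn r) \<tau> h" "\<not> spoiled D h"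
      using that by (auto simp: plays_def)
    have "\<not> first_turn r j" if j: "length (h @ [b]) \<le> j" "j < length (h @ [b]) + (r - 1)" for j
    proof -
      have "j = m * r + (j - m * r)" "0 < j - m * r" "j - m * r < r"
        using j h(1) assms by auto
      then show ?thesis by (metis mod_less mod_mult_self3 not_gr_zero)
    qed
    then obtain g where g: "length g = r - 1" "answers (first_turn r) \<tau> ((h @ [b]) @ g)"
      using extend_by_answers[of "first_turn r" \<tau> "h @ [b]" "r - 1"] h by (auto simp: answers_snoc)
    then have "(h @ [b]) @ g \<in> continuations r \<tau> D m"
      using h assms by (simp add: continuations_def)
    then show ?thesis using h(1) by (intro bexI[of _ "(h @ [b]) @ g"]) auto
  qed
  then obtain f where f: "\<And>h b. h \<in> plays r \<tau> D m \<Longrightarrow>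
      f h b \<in> continuations r \<tau> D m \<and> take (Suc (m * r)) (f h b) = h @ [b]"
    by metis
  have "inj_on (\<lambda>(h, b). f h b) (plays r \<tau> D m \<times> UNIV)"
    by (rule inj_onI) (use f in \<open>force dest: arg_cong[of _ _ "take (Suc (m * r))"]\<close>)
  then have "card (plays r \<tau> D m \<times> (UNIV :: bool set)) \<le> card (continuations r \<tau> D m)"
    by (rule card_inj_on_le) (use f finite_continuations in auto)
  then show ?thesis by (simp add: card_cartesian_product)
qed

text \<open>
  Inside the later block each digit is a copy of the digit \<open>d\<close> places before it, and after the
  block there are only forced moves of Player 2.
\<close>

lemma repeats_determined:
  assumes h: "answers T \<tau> h" "repeats n d e h"
    and h': "answers T \<tau> h'" "repeats n d e h'"
    and len: "length h = length h'" and "0 < d" and "e - n \<le> s"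
    and no_turn: "\<And>j. e \<le> j \<Longrightarrow> j < length h \<Longrightarrow> \<not> T j"
    and same: "take s h = take s h'"
  shows "h = h'"
proof (rule nth_equalityI[OF len])
  fix i assume "i < length h"
  then show "h ! i = h' ! i"
  \<comment> \<open>Strong induction is used because, for overlapping blocks, \<open>i - d\<close>
    may itself lie in the later block.\<close>
  proof (induction i rule: less_induct)
    case (less i)
    consider "i < s" | "s \<le> i" "i < e" | "e \<le> i" by linarith
    then show ?case
    proof cases
      case 1
      then show ?thesis using same by (metis nth_take)
    next
      case 2
      then have "i \<in> {e - n..<e}" using \<open>e - n \<le> s\<close> by simp
      then have "h ! i = h ! (i - d)" "h' ! i = h' ! (i - d)" "i - d < i"
        using h(2) h'(2) \<open>0 < d\<close> unfolding repeats_def by auto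
      then show ?thesis using less by auto
    next
      case 3
      have "take i h = take i h'"
        using less len by (intro nth_take_lemma) auto
      then show ?thesis
        using 3 no_turn[OF 3] less.prems h(1) h'(1) len by (simp add: answers_def)
    qed
  qed
qed

text \<open>The later block ends inside the last round and covers at least \<open>n div r\<close>
  rounds' worth of digits, so it starts within the first \<open>Suc m - n div r\<close> rounds. By
  \<open>repeats_determined\<close> this prefix fixes the continuation, and it is unspoiled since
  \<open>r \<le> n\<close> keeps it within the first \<open>m\<close> rounds.\<close>

lemma card_spoiled_continuations:
  assumes "0 < r" "r \<le> n" "0 < d" "m * r < e"
  shows "card {h \<in> continuations r \<tau> D m. repeats n d e h} \<le> card (plays r \<tau> D (Suc m - n div r))"
    (is "card ?A \<le> card (plays r \<tau> D ?q)")
proof -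
  have "1 \<le> n div r" using assms(1,2) by (simp add: Suc_leI div_greater_zero_iff)
  then have q: "?q \<le> m" by simp
  have len: "length h = Suc m * r" if "h \<in> ?A" for h using that by (simp add: continuations_def)
  have "take (?q * r) h \<in> plays r \<tau> D ?q" if "h \<in> ?A" for h
  proof -
    have "take (m * r) h \<in> plays r \<tau> D m"
      using that by (auto simp: continuations_def plays_def answers_take)
    from take_in_plays[OF this q] show ?thesis
      using q by (simp add: min_absorb1)
  qed
  moreover have "inj_on (take (?q * r)) ?A"
  proof (rule inj_onI)
    fix h h' assume A: "h \<in> ?A" "h' \<in> ?A" and same: "take (?q * r) h = take (?q * r) h'"
    have "e \<le> Suc m * r" using A(1) len[OF A(1)] by (simp add: repeats_def)
    moreover have "n div r * r \<le> n" by (simp add: div_times_less_eq_dividend)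
    ultimately have start: "e - n \<le> ?q * r"
      unfolding diff_mult_distrib by linarith
    have no_turn: "\<not> first_turn r j" if j: "e \<le> j" "j < length h" for j
    proof -
      have "m * r < j" "j < Suc m * r" using j len[OF A(1)] assms(4) by auto
      then have "j - m * r < r" "0 < j - m * r" "j = m * r + (j - m * r)" by auto
      then show ?thesis by (metis mod_less mod_mult_self3 not_gr_zero)
    qed
    show "h = h'"
      using A len[OF A(1)] len[OF A(2)]
      by (intro repeats_determined[OF _ _ _ _ _ assms(3) start no_turn same])
        (auto simp: continuations_def)
  qed
  ultimately show ?thesis
    by (intro card_inj_on_le[of "take (?q * r)"]) (auto simp: finite_plays)
qed

text \<open>Union bound: a spoiled continuation has a repetition ending in the last round, as an
  earlier one would spoil the prefix. The factor \<open>D n\<close> counts the distances and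
  \<open>r\<close> the possible ends.\<close>

lemma card_plays_Suc:
  assumes "0 < r" and D: "\<And>n. n < r \<Longrightarrow> D n = 0"
  shows "2 * card (plays r \<tau> D m) \<le> card (plays r \<tau> D (Suc m)) +
    (\<Sum>n\<in>{r..Suc m * r}. r * D n * card (plays r \<tau> D (Suc m - n div r)))"
proof -
  let ?C = "continuations r \<tau> D m"
  let ?A = "\<lambda>n d e. {h \<in> ?C. repeats n d e h}"
  let ?U = "\<Union>n\<in>{r..Suc m * r}. \<Union>d\<in>{1..D n}. \<Union>e\<in>{m * r<..Suc m * r}. ?A n d e"
  have "?C \<subseteq> plays r \<tau> D (Suc m) \<union> ?U"
  proof
    fix h assume h: "h \<in> ?C"
    then have len: "length h = Suc m * r" by (simp add: continuations_def)
    show "h \<in> plays r \<tau> D (Suc m) \<union> ?U"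
    proof (cases "spoiled D h")
      case False
      then show ?thesis using h by (simp add: continuations_def plays_def)
    next
      case True
      then obtain n e d where d: "d \<in> {1..D n}" and rep: "repeats n d e h"
        by (auto simp: spoiled_def)
      have "\<not> repeats n d e (take (m * r) h)"
        using h d unfolding continuations_def spoiled_def by blast
      then have "m * r < e" using repeats_take rep by (meson not_le)
      moreover have "e \<le> Suc m * r" "n \<le> e" using rep len by (auto simp: repeats_def)
      moreover have "r \<le> n" using d D[of n] by (cases "n < r") auto
      ultimately have "n \<in> {r..Suc m * r}" "e \<in> {m * r<..Suc m * r}" by auto
      with h d rep show ?thesis by blast
    qed
  qed
  then have "card ?C \<le> card (plays r \<tau> D (Suc m) \<union> ?U)"
    by (rule card_mono[rotated]) (auto simp: finite_plays finite_continuations)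
  also have "\<dots> \<le> card (plays r \<tau> D (Suc m)) + card ?U"
    by (rule card_Un_le)
  also have "card ?U \<le> (\<Sum>n\<in>{r..Suc m * r}. r * D n * card (plays r \<tau> D (Suc m - n div r)))"
  proof -
    have "card (\<Union>d\<in>{1..D n}. \<Union>e\<in>{m * r<..Suc m * r}. ?A n d e)
        \<le> r * D n * card (plays r \<tau> D (Suc m - n div r))" if "n \<in> {r..Suc m * r}" for n
    proof -
      have "card (\<Union>e\<in>{m * r<..Suc m * r}. ?A n d e) \<le> r * card (plays r \<tau> D (Suc m - n div r))"
        if "d \<in> {1..D n}" for d
      proof -
        have "card (\<Union>e\<in>{m * r<..Suc m * r}. ?A n d e)
            \<le> (\<Sum>e\<in>{m * r<..Suc m * r}. card (?A n d e))"
          by (rule card_UN_le) simp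
        also have "\<dots> \<le> (\<Sum>e\<in>{m * r<..Suc m * r}. card (plays r \<tau> D (Suc m - n div r)))"
          using that \<open>n \<in> _\<close> assms(1) by (intro sum_mono card_spoiled_continuations) auto
        finally show ?thesis by simp
      qed
      then have "(\<Sum>d\<in>{1..D n}. card (\<Union>e\<in>{m * r<..Suc m * r}. ?A n d e))
          \<le> (\<Sum>d\<in>{1..D n}. r * card (plays r \<tau> D (Suc m - n div r)))"
        by (rule sum_mono)
      moreover have "card (\<Union>d\<in>{1..D n}. \<Union>e\<in>{m * r<..Suc m * r}. ?A n d e)
          \<le> (\<Sum>d\<in>{1..D n}. card (\<Union>e\<in>{m * r<..Suc m * r}. ?A n d e))"
        by (rule card_UN_le) simp
      ultimately show ?thesis by (simp add: algebra_simps)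
    qed
    then show ?thesis
      by (intro order_trans[OF card_UN_le[OF finite_atLeastAtMost] sum_mono])
  qed
  finally show ?thesis using card_continuations[OF assms(1), of \<tau> D m] by linarith
qed

text \<open>The growth already known for earlier rounds bounds each subtracted count by
  \<open>card (plays r \<tau> D m)\<close> divided by a power of \<open>\<beta>\<close>. The total
  loss is then at most \<open>2 - \<beta>\<close> times that cardinality, which leaves the factor
  \<open>\<beta>\<close> out of 2.\<close>

lemma card_plays_growth:
  fixes \<beta> :: real
  assumes "0 < r" and D: "\<And>n. n < r \<Longrightarrow> D n = 0" and "0 < \<beta>"
    and small: "\<And>L. (\<Sum>n\<in>{r..L}. real r * real (D n) / \<beta> ^ (n div r - 1)) \<le> 2 - \<beta>"
  shows "\<beta> * card (plays r \<tau> D m) \<le> card (plays r \<tau> D (Suc m))"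
proof (induction m rule: less_induct)
  case (less m)
  define C where "C m = real (card (plays r \<tau> D m))" for m
  have iter: "C (m - j) * \<beta> ^ j \<le> C m" if "j \<le> m" for j
    using that
  proof (induction j)
    case (Suc j)
    then have "\<beta> * C (m - Suc j) \<le> C (m - j)"
      using less[of "m - Suc j"] by (simp add: C_def Suc_diff_Suc)
    then have "C (m - Suc j) * \<beta> ^ Suc j \<le> C (m - j) * \<beta> ^ j"
      using mult_right_mono[of _ _ "\<beta> ^ j"] \<open>0 < \<beta>\<close> by (fastforce simp: mult_ac)
    with Suc show ?case by simp
  qed simp
  have "real (r * D n * card (plays r \<tau> D (Suc m - n div r)))
      \<le> real r * real (D n) / \<beta> ^ (n div r - 1) * C m" if "n \<in> {r..Suc m * r}" for n
  proof -
    have "1 \<le> n div r" using that assms(1) by (simp add: Suc_leI div_greater_zero_iff)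
    moreover have "n div r \<le> Suc m"
      using that assms(1) div_le_mono[of n "Suc m * r" r] by simp
    \<comment> \<open>For \<open>j = n div r - 1\<close> the index \<open>m - j\<close> is
      \<open>Suc m - n div r\<close>; the two bounds on \<open>n div r\<close> exclude truncated
      subtraction.\<close>
    ultimately have "C (Suc m - n div r) * \<beta> ^ (n div r - 1) \<le> C m"
      using iter[of "n div r - 1"] by simp
    then have "C (Suc m - n div r) \<le> C m / \<beta> ^ (n div r - 1)"
      using \<open>0 < \<beta>\<close> by (simp add: field_simps)
    then have "real r * real (D n) * C (Suc m - n div r)
        \<le> real r * real (D n) * (C m / \<beta> ^ (n div r - 1))"
      by (rule mult_left_mono) simp
    then show ?thesis by (simp add: C_def)
  qed
  then have "real (\<Sum>n\<in>{r..Suc m * r}. r * D n * card (plays r \<tau> D (Suc m - n div r)))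
      \<le> (\<Sum>n\<in>{r..Suc m * r}. real r * real (D n) / \<beta> ^ (n div r - 1) * C m)"
    unfolding of_nat_sum by (rule sum_mono)
  also have "\<dots> \<le> (2 - \<beta>) * C m"
    unfolding sum_distrib_right[symmetric]
    by (rule mult_right_mono[OF small]) (simp add: C_def)
  finally have "real (\<Sum>n\<in>{r..Suc m * r}. r * D n * card (plays r \<tau> D (Suc m - n div r)))
      \<le> (2 - \<beta>) * C m" .
  moreover have "2 * C m \<le> C (Suc m) +
      real (\<Sum>n\<in>{r..Suc m * r}. r * D n * card (plays r \<tau> D (Suc m - n div r)))"
    using of_nat_mono[OF card_plays_Suc[where \<tau> = \<tau> and m = m, OF assms(1) D], where 'a = real]
    unfolding C_def by simp
  ultimately show ?case by (simp add: C_def algebra_simps)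
qed

text \<open>The counts start at 1 and grow by a positive factor, so none vanishes. Hence every
  \<open>\<tau>\<close> admits unspoiled plays of any number of rounds, as determinacy
  requires.\<close>

lemma strategy_avoiding_repeats:
  fixes \<beta> :: real
  assumes "0 < r" and D: "\<And>n. n < r \<Longrightarrow> D n = 0" and "0 < \<beta>"
    and small: "\<And>L. (\<Sum>n\<in>{r..L}. real r * real (D n) / \<beta> ^ (n div r - 1)) \<le> 2 - \<beta>"
  shows "\<exists>\<sigma>. \<forall>\<alpha>. (\<forall>j. first_turn r j \<longrightarrow> \<alpha> j = \<sigma> (map \<alpha> [0..<j])) \<longrightarrow>
    (\<forall>n. \<not> spoiled D (map \<alpha> [0..<n]))"
proof (rule closed_game_determined)
  fix \<tau> M
  have "0 < real (card (plays r \<tau> D m))" for m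
  proof (induction m)
    case 0
    then show ?case using card_plays_0[of D r \<tau>] D[OF assms(1)] by simp
  next
    case (Suc m)
    then have "0 < \<beta> * card (plays r \<tau> D m)" using \<open>0 < \<beta>\<close> by simp
    also have "\<dots> \<le> card (plays r \<tau> D (Suc m))" by (rule card_plays_growth[OF assms])
    finally show ?case .
  qed
  from this[of M] obtain h where "h \<in> plays r \<tau> D M" by (fastforce simp: card_gt_0_iff)
  moreover have "M \<le> M * r" using assms(1) by simp
  ultimately show "\<exists>h. answers (first_turn r) \<tau> h \<and> M \<le> length h \<and> (\<forall>n\<le>M. \<not> spoiled D (take n h))"
    by (auto simp: plays_def dest: spoiled_take)
qed

section \<open>Choice of the parameters\<close>

text \<open>The terms are dominated by a geometric series with ratio
  \<open>\<theta> = (a / \<beta>) powr (1 / real r)\<close>, which is below 1 because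
  \<open>a < \<beta>\<close>.\<close>

lemma small_tail:
  fixes a \<beta> \<delta> :: real
  assumes "0 < r" "0 < a" "a < \<beta>" "1 \<le> \<beta>" "0 < \<delta>"
  shows "\<exists>N. \<forall>L. (\<Sum>n\<in>{N..L}. real r * (a powr (real n / real r)) / \<beta> ^ (n div r - 1)) \<le> \<delta>"
proof -
  define \<theta> where "\<theta> = (a / \<beta>) powr (1 / real r)"
  have "\<theta> < 1" using assms by (simp add: \<theta>_def powr01_less_one)
  have "0 \<le> \<theta>" by (simp add: \<theta>_def)
  have bound: "real r * (a powr (real n / real r)) / \<beta> ^ (n div r - 1) \<le> (real r * \<beta>\<^sup>2) * \<theta> ^ n" for n
  proof -
    have "real n < real ((n div r + 1) * r)"
      using assms(1) by (metis Suc_eq_plus1 dividend_less_div_times mult_Suc of_nat_less_iff)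
    then have "real n / real r < real (n div r) + 1"
      using assms(1) by (simp add: field_simps)
    \<comment> \<open>Rounding in \<open>n div r\<close> costs less than one and the
      \<open>- 1\<close> at most one more, whence the factor \<open>\<beta>\<^sup>2\<close>.\<close>
    then have "real n / real r - 2 \<le> real (n div r - 1)" by linarith
    then have "\<beta> powr (real n / real r - 2) \<le> \<beta> ^ (n div r - 1)"
      using assms(4) powr_mono[of "real n / real r - 2" "real (n div r - 1)" \<beta>]
      by (simp add: powr_realpow)
    then have "a powr (real n / real r) / \<beta> ^ (n div r - 1)
        \<le> a powr (real n / real r) / \<beta> powr (real n / real r - 2)"
      using assms by (intro divide_left_mono) auto
    also have "\<dots> = \<beta>\<^sup>2 * (a / \<beta>) powr (real n / real r)"
      using assms by (simp add: powr_diff powr_divide)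
    also have "(a / \<beta>) powr (real n / real r) = \<theta> ^ n"
      using assms by (simp add: \<theta>_def powr_powr flip: powr_realpow)
    finally have "real r * (a powr (real n / real r) / \<beta> ^ (n div r - 1)) \<le> real r * (\<beta>\<^sup>2 * \<theta> ^ n)"
      by (rule mult_left_mono) simp
    then show ?thesis by simp
  qed
  have "summable (\<lambda>n. (real r * \<beta>\<^sup>2) * \<theta> ^ n)"
    using \<open>0 \<le> \<theta>\<close> \<open>\<theta> < 1\<close> by (intro summable_mult summable_geometric) simp
  then obtain N where N: "\<And>m L. N \<le> m \<Longrightarrow> norm (\<Sum>n\<in>{m..<L}. (real r * \<beta>\<^sup>2) * \<theta> ^ n) < \<delta>"
    using assms(5) unfolding summable_Cauchy by meson
  have "(\<Sum>n\<in>{N..L}. real r * (a powr (real n / real r)) / \<beta> ^ (n div r - 1)) \<le> \<delta>" for L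
  proof -
    have "(\<Sum>n\<in>{N..L}. real r * (a powr (real n / real r)) / \<beta> ^ (n div r - 1))
        \<le> (\<Sum>n\<in>{N..L}. (real r * \<beta>\<^sup>2) * \<theta> ^ n)"
      by (rule sum_mono) (rule bound)
    also have "\<dots> \<le> \<delta>" using N[of N "Suc L"] by (simp add: atLeastLessThanSuc_atLeastAtMost)
    finally show ?thesis .
  qed
  then show ?thesis by blast
qed

text \<open>Turns are numbered from 1 but list positions from 0, so the residue 1 becomes 0.\<close>

lemma player1_turn_Suc: "player1_turn t (Suc j) \<longleftrightarrow> first_turn (t + 1) j"
  unfolding player1_turn_def using cong_add_rcancel_nat[of j 1 0 "t + 1"] by (simp add: cong_def)

theorem theorem1p4:
  fixes t :: nat and \<epsilon> :: real
  assumes "t \<ge> 1" and "0 < \<epsilon>" and "\<epsilon> < 2"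
  shows "\<exists>N :: nat. \<exists>\<sigma> :: strategy.
    ensures t \<sigma> (\<lambda>\<alpha>. \<forall>k l n. k < l \<and> n > N \<and> identical_blocks \<alpha> n k l \<longrightarrow>
      real (l - k) > (2 - \<epsilon>) powr (real n / real (t + 1)))"
proof -
  define r where "r = t + 1"
  \<comment> \<open>\<open>\<beta>\<close> lies strictly between \<open>a\<close> and 2:
    \<open>a < \<beta>\<close> makes the tail small, and \<open>\<beta> < 2\<close> leaves it the
    room \<open>2 - \<beta> = \<epsilon> / 2\<close>.\<close>
  define \<beta> where "\<beta> = 2 - \<epsilon> / 2"
  define a where "a = 2 - \<epsilon>"
  have "0 < r" by (simp add: r_def)
  obtain N' where N': "\<And>L. (\<Sum>n\<in>{N'..L}. real r * (a powr (real n / real r)) / \<beta> ^ (n div r - 1)) \<le> 2 - \<beta>"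
    using small_tail[of r a \<beta> "2 - \<beta>"] assms \<open>0 < r\<close> by (auto simp: a_def \<beta>_def)
  \<comment> \<open>Taking \<open>N\<close> at least \<open>r\<close> makes \<open>D\<close> vanish
    below \<open>r\<close>, and \<open>N'\<close> ensures that the remaining sum is small. The floor
    in \<open>D\<close> is the number of positive integers not exceeding the required distance
    bound.\<close>
  define N where "N = max N' r"
  define D where "D n = (if N < n then nat \<lfloor>a powr (real n / real r)\<rfloor> else 0)" for n
  have \<beta>: "0 < \<beta>" using assms by (simp add: \<beta>_def)
  have "(\<Sum>n\<in>{r..L}. real r * real (D n) / \<beta> ^ (n div r - 1)) \<le> 2 - \<beta>" for L
  proof -
    have "(\<Sum>n\<in>{r..L}. real r * real (D n) / \<beta> ^ (n div r - 1))
        = (\<Sum>n\<in>{N<..L}. real r * real (D n) / \<beta> ^ (n div r - 1))"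
      by (rule sum.mono_neutral_right) (auto simp: D_def N_def)
    also have "\<dots> \<le> (\<Sum>n\<in>{N<..L}. real r * (a powr (real n / real r)) / \<beta> ^ (n div r - 1))"
      using \<beta> by (intro sum_mono divide_right_mono mult_left_mono) (auto simp: D_def)
    also have "\<dots> \<le> (\<Sum>n\<in>{N'..L}. real r * (a powr (real n / real r)) / \<beta> ^ (n div r - 1))"
      using \<beta> by (intro sum_mono2) (auto simp: N_def)
    finally show ?thesis using N'[of L] by linarith
  qed
  moreover have "D n = 0" if "n < r" for n using that by (simp add: D_def N_def)
  ultimately obtain \<sigma> where \<sigma>: "\<And>\<alpha> n. (\<And>j. first_turn r j \<Longrightarrow> \<alpha> j = \<sigma> (map \<alpha> [0..<j])) \<Longrightarrow>
      \<not> spoiled D (map \<alpha> [0..<n])"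
    using strategy_avoiding_repeats[OF \<open>0 < r\<close>, of D \<beta>] \<beta> by metis
  have "a powr (real n / real r) < real (l - k)"
    if fol: "follows t \<sigma> \<alpha>" and "k < l" "N < n" and same: "identical_blocks \<alpha> n k l" for \<alpha> k l n
  proof (rule ccontr)
    assume far: "\<not> ?thesis"
    \<comment> \<open>The shift puts \<open>\<alpha> 1\<close> at list position 0, so that the later
      block occupies positions \<open>l\<close> up to, but excluding, \<open>l + n\<close>.\<close>
    define \<alpha>' where "\<alpha>' j = \<alpha> (Suc j)" for j
    have "map \<alpha>' [0..<j] = history \<alpha> (Suc j)" for j
      by (simp add: \<alpha>'_def history_def map_Suc_upt[symmetric] del: map_Suc_upt upt_Suc)
    then have "\<alpha>' j = \<sigma> (map \<alpha>' [0..<j])" if "first_turn r j" for j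
      using fol that by (auto simp: \<alpha>'_def follows_def player1_turn_Suc r_def)
    then have "\<not> spoiled D (map \<alpha>' [0..<l + n])" by (rule \<sigma>)
    moreover have "repeats n (l - k) (l + n) (map \<alpha>' [0..<l + n])"
      unfolding repeats_def
    proof (intro conjI ballI)
      fix i assume "i \<in> {l + n - n..<l + n}"
      then obtain i' where i': "i = l + i'" "i' < n" by (auto simp: le_iff_add)
      then have "\<alpha> (k + Suc i') = \<alpha> (l + Suc i')"
        using same unfolding identical_blocks_def by (metis Suc_leI atLeastAtMost_iff le_add1 plus_1_eq_Suc)
      then show "map \<alpha>' [0..<l + n] ! i = map \<alpha>' [0..<l + n] ! (i - (l - k))"
        using i' \<open>k < l\<close> by (simp add: \<alpha>'_def add.commute)
    qed (use \<open>k < l\<close> in auto)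
    moreover have "l - k \<in> {1..D n}"
      using far \<open>k < l\<close> \<open>N < n\<close> by (auto simp: D_def le_nat_floor)
    ultimately show False unfolding spoiled_def by blast
  qed
  then show ?thesis unfolding ensures_def a_def r_def by blast
qed

end
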